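(* Let $V$ be a finite-dimensional irreducible representation of $\mathfrak{sl}(2,\mathbb C)$, and let $v\in V$ satisfy $Hv = \lambda v$ for some $\lambda\neq 0$. If neither $E$ nor $F$ annihilates $v$, then $V\otimes\mathfrak{sl}(2,\mathbb C)$ is generated, as an $\mathfrak{sl}(2,\mathbb C)$-module, by $v\otimes H$ together with the $\mathfrak{sl}(2,\mathbb C)$-overshears of $V\otimes\mathfrak{sl}(2,\mathbb C)$.
   Context: $\mathfrak{sl}(2,\mathbb C)$ has basis $E,F,H$ with $[H,E]=2E$, $[H,F]=-2F$, $[E,F]=H$. The module structure on $V\otimes\mathfrak{sl}(2,\mathbb C)$ is $\xi(w\otimes\eta) = \xi w\otimes\eta + w\otimes[\xi,\eta]$. An element $w\otimes\xi$ is an overshear if $\xi^2 w = 0$. *)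

theory Defs
  imports "HOL-Analysis.Analysis"
begin

text \<open>A finite-dimensional representation V of sl(2,C) is modelled as V = C^n
  (n = CARD('n), an arbitrary finite index type) together with the matrices
  E, F, H by which the basis elements act.  An element of sl(2,C) is written
  by its coordinates (a,b,c) meaning aE + bF + cH.\<close>

type_synonym sl2 = "complex \<times> complex \<times> complex"

definition sl2E :: sl2 where "sl2E = (1, 0, 0)"
definition sl2F :: sl2 where "sl2F = (0, 1, 0)"
definition sl2H :: sl2 where "sl2H = (0, 0, 1)"

text \<open>Lie bracket, from [H,E]=2E, [H,F]=-2F, [E,F]=H, bilinearity and antisymmetry.\<close>
definition sl2_bracket :: "sl2 \<Rightarrow> sl2 \<Rightarrow> sl2" where
  "sl2_bracket = (\<lambda>(a,b,c) (a',b',c').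
     (2 * (c * a' - a * c'), 2 * (b * c' - c * b'), a * b' - b * a'))"

definition is_sl2_rep :: "complex^'n^'n \<Rightarrow> complex^'n^'n \<Rightarrow> complex^'n^'n \<Rightarrow> bool" where
  "is_sl2_rep E F H \<longleftrightarrow>
     H ** E - E ** H = mat 2 ** E \<and>
     H ** F - F ** H = - (mat 2 ** F) \<and>
     E ** F - F ** E = H"

text \<open>Action of an element of sl(2,C) on V.\<close>
definition rep :: "complex^'n^'n \<Rightarrow> complex^'n^'n \<Rightarrow> complex^'n^'n \<Rightarrow> sl2
                   \<Rightarrow> complex^'n \<Rightarrow> complex^'n" where
  "rep E F H = (\<lambda>(a,b,c) w. a *s (E *v w) + b *s (F *v w) + c *s (H *v w))"

definition csubspace :: "(complex^'n) set \<Rightarrow> bool" where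
  "csubspace S \<longleftrightarrow> 0 \<in> S \<and> (\<forall>x\<in>S. \<forall>y\<in>S. x + y \<in> S) \<and> (\<forall>c. \<forall>x\<in>S. c *s x \<in> S)"

definition irreducible_rep :: "complex^'n^'n \<Rightarrow> complex^'n^'n \<Rightarrow> complex^'n^'n \<Rightarrow> bool" where
  "irreducible_rep E F H \<longleftrightarrow>
     (\<forall>S. csubspace S \<and> (\<forall>w\<in>S. E *v w \<in> S \<and> F *v w \<in> S \<and> H *v w \<in> S)
          \<longrightarrow> S = {0} \<or> S = UNIV)"

text \<open>V \<otimes> sl(2,C) is modelled as V \<times> V \<times> V, the triple (x,y,z) standing for
  x\<otimes>E + y\<otimes>F + z\<otimes>H.\<close>
type_synonym ('n) tens = "(complex^'n) \<times> (complex^'n) \<times> (complex^'n)"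

definition tensor :: "complex^'n \<Rightarrow> sl2 \<Rightarrow> ('n::finite) tens" where
  "tensor w = (\<lambda>(a,b,c). (a *s w, b *s w, c *s w))"

definition tscale :: "complex \<Rightarrow> ('n::finite) tens \<Rightarrow> ('n::finite) tens" where
  "tscale k = (\<lambda>(x,y,z). (k *s x, k *s y, k *s z))"

text \<open>Module action: xi(w (x) eta) = xi w (x) eta + w (x) [xi,eta], extended linearly.\<close>
definition tact :: "complex^'n^'n \<Rightarrow> complex^'n^'n \<Rightarrow> complex^'n^'n \<Rightarrow> sl2
                    \<Rightarrow> ('n::finite) tens \<Rightarrow> ('n::finite) tens" where
  "tact E F H \<xi> = (\<lambda>(x,y,z).
      tensor (rep E F H \<xi> x) sl2E + tensor x (sl2_bracket \<xi> sl2E)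
    + tensor (rep E F H \<xi> y) sl2F + tensor y (sl2_bracket \<xi> sl2F)
    + tensor (rep E F H \<xi> z) sl2H + tensor z (sl2_bracket \<xi> sl2H))"

definition tsubmodule :: "complex^'n^'n \<Rightarrow> complex^'n^'n \<Rightarrow> complex^'n^'n \<Rightarrow> ('n::finite) tens set \<Rightarrow> bool" where
  "tsubmodule E F H S \<longleftrightarrow>
     0 \<in> S \<and> (\<forall>x\<in>S. \<forall>y\<in>S. x + y \<in> S) \<and> (\<forall>k. \<forall>x\<in>S. tscale k x \<in> S) \<and>
     (\<forall>\<xi>. \<forall>x\<in>S. tact E F H \<xi> x \<in> S)"

text \<open>Submodule generated by a set.\<close>
definition generated :: "complex^'n^'n \<Rightarrow> complex^'n^'n \<Rightarrow> complex^'n^'n \<Rightarrow> ('n::finite) tens set \<Rightarrow> ('n::finite) tens set" where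
  "generated E F H X = \<Inter>{S. tsubmodule E F H S \<and> X \<subseteq> S}"

text \<open>sl(2,C)-overshears: w\<otimes>\<xi> with xi^2 w = 0.\<close>
definition overshears :: "complex^'n^'n \<Rightarrow> complex^'n^'n \<Rightarrow> complex^'n^'n \<Rightarrow> ('n::finite) tens set" where
  "overshears E F H = {tensor w \<xi> | w \<xi>. rep E F H \<xi> (rep E F H \<xi> w) = 0}"

end

theory Submission
  imports Defs
begin

text \<open>
  Raising v with E until the next step vanishes gives a highest weight vector u; lowering it
  gives the string X k = F^k u, k = 0..K, with H u = K u. By irreducibility the X k span V, and
  as their weights are distinct, v = a X m, where 0 < m < K because E v and F v are nonzero.

  Write x \<otimes> E + y \<otimes> F + z \<otimes> H as (x, y, z). The overshears (u, 0, 0) and (X 1, 0, 0) give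
  (0, 0, u), and repeated application of F yields (0, 2(k+1) X k, X (k+1)) and
  (X (k+2), -(k+2)(k+1) X k, -(k+2) X (k+1)). Together with (0, 0, X m), coming from v \<otimes> H,
  these give (0, X (m-1), 0) and (X (m+1), 0, 0). Applying E then produces (X m, 0, 0),
  (X (m-1), 0, 0) and (0, 0, X (m-1)), up to the factors (m+1)(K-m) and m(K-m+1), which are
  nonzero precisely because 0 < m < K. Finally, once w \<otimes> E, w \<otimes> F and w \<otimes> H lie in a
  submodule for some w \<noteq> 0, the x with the same property form a nonzero subrepresentation of V,
  hence all of V, and the submodule is everything.
\<close>

lemma matrix_vector_mul_mat: "mat c *v x = c *s x"
  by (simp add: vec_eq_iff matrix_vector_mult_def mat_def mult_delta_left)

lemma funpow_matrix_vector_mult_zero: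
  fixes A :: "'a::semiring_1^'n^'n"
  shows "((*v) A ^^ k) 0 = 0"
  by (induction k) simp_all

lemma funpow_matrix_vector_mult_eq_0_mono:
  fixes A :: "'a::semiring_1^'n^'n"
  assumes "((*v) A ^^ k) x = 0" "k \<le> l"
  shows "((*v) A ^^ l) x = 0"
proof -
  obtain j where "l = j + k" using assms(2) by (metis le_add_diff_inverse2)
  then show ?thesis using assms(1) by (simp add: funpow_add funpow_matrix_vector_mult_zero)
qed

lemma matrix_vector_mult_in_span:
  assumes "(*v) A ` S \<subseteq> vec.span S" "y \<in> vec.span S"
  shows "A *v y \<in> vec.span S"
proof -
  have "(*v) A ` vec.span S = vec.span ((*v) A ` S)" by (rule vec.span_image[symmetric])
  also have "\<dots> \<subseteq> vec.span S" using assms(1) by (simp add: vec.span_minimal)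
  finally show ?thesis using assms(2) by blast
qed

lemma funpow_eigenvector:
  fixes H A :: "'a::comm_ring_1^'n^'n"
  assumes shift: "\<And>x b. H *v x = b *s x \<Longrightarrow> H *v (A *v x) = (b + d) *s (A *v x)"
    and "H *v w = c *s w"
  shows "H *v ((*v) A ^^ k) w = (c + of_nat k * d) *s ((*v) A ^^ k) w"
proof (induction k)
  case (Suc k)
  from shift[OF Suc] show ?case by (simp add: algebra_simps)
qed (simp add: assms)

lemma eigenvector_in_span_eq_0:
  fixes H :: "'a::field^'n^'n"
  assumes "finite I" "\<And>i. i \<in> I \<Longrightarrow> H *v g i = ev i *s g i"
    and "\<And>i. i \<in> I \<Longrightarrow> ev i \<noteq> c" "x \<in> vec.span (g ` I)" "H *v x = c *s x"
  shows "x = 0"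
  using assms
proof (induction I arbitrary: x rule: finite_induct)
  case empty
  then show ?case by simp
next
  case (insert i I)
  from \<open>x \<in> vec.span (g ` insert i I)\<close> obtain a where y: "x - a *s g i \<in> vec.span (g ` I)"
    by (auto simp: vec.span_breakdown_eq)
  have "(*v) H ` g ` I \<subseteq> vec.span (g ` I)"
    using insert.prems(1) by (auto simp: vec.span_scale vec.span_base)
  then have "H *v (x - a *s g i) - ev i *s (x - a *s g i) \<in> vec.span (g ` I)"
    using y matrix_vector_mult_in_span by (blast intro: vec.span_diff vec.span_scale)
  moreover have "H *v (x - a *s g i) - ev i *s (x - a *s g i) = (c - ev i) *s x"
    using insert.prems(1,4) by (simp add: vec.diff vec.scale algebra_simps)
  ultimately have "(1 / (c - ev i)) *s ((c - ev i) *s x) \<in> vec.span (g ` I)"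
    by (metis vec.span_scale)
  moreover have "c - ev i \<noteq> 0" using insert.prems(2) by force
  ultimately have "x \<in> vec.span (g ` I)"
    by (simp only: vector_smult_assoc) simp
  then show ?case using insert.IH insert.prems by simp
qed

lemma eigenvector_notin_span_others:
  fixes H :: "'a::field^'n^'n"
  assumes "finite I" "inj_on ev I" "\<And>i. i \<in> I \<Longrightarrow> H *v g i = ev i *s g i"
    and "i \<in> I" "g i \<noteq> 0"
  shows "g i \<notin> vec.span (g ` (I - {i}))"
proof
  assume "g i \<in> vec.span (g ` (I - {i}))"
  moreover have "ev j \<noteq> ev i" if "j \<in> I - {i}" for j
    using that \<open>i \<in> I\<close> \<open>inj_on ev I\<close> by (auto dest: inj_onD)
  ultimately have "g i = 0"
    using assms(1,3,4) by (intro eigenvector_in_span_eq_0[of "I - {i}" H g ev "ev i"]) auto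
  then show False using \<open>g i \<noteq> 0\<close> by contradiction
qed

lemma independent_eigenvectors:
  fixes H :: "'a::field^'n^'n"
  assumes "finite I" "inj_on ev I" "\<And>i. i \<in> I \<Longrightarrow> H *v g i = ev i *s g i"
    and "\<And>i. i \<in> I \<Longrightarrow> g i \<noteq> 0"
  shows "vec.independent (g ` I)" and "inj_on g I"
proof -
  have notin: "g i \<notin> vec.span (g ` (I - {i}))" if "i \<in> I" for i
    using eigenvector_notin_span_others[OF assms(1-3) that assms(4)[OF that]] .
  show "vec.independent (g ` I)"
    unfolding vec.dependent_def
  proof clarify
    fix i assume "i \<in> I" "g i \<in> vec.span (g ` I - {g i})"
    moreover have "g ` I - {g i} \<subseteq> g ` (I - {i})" by blast
    ultimately show False using notin vec.span_mono by blast
  qed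
  show "inj_on g I"
  proof (rule inj_onI, rule ccontr)
    fix i j assume "i \<in> I" "j \<in> I" "g i = g j" "i \<noteq> j"
    then have "g i \<in> vec.span (g ` (I - {i}))" by (metis DiffI image_eqI singletonD vec.span_base)
    then show False using notin \<open>i \<in> I\<close> by blast
  qed
qed

lemma eigenvector_in_span_eq_multiple:
  fixes H :: "'a::field^'n^'n"
  assumes "finite I" "inj_on ev I" "\<And>i. i \<in> I \<Longrightarrow> H *v g i = ev i *s g i"
    and "x \<in> vec.span (g ` I)" "H *v x = c *s x" "x \<noteq> 0"
  obtains i a where "i \<in> I" "x = a *s g i"
proof -
  obtain i where i: "i \<in> I" "ev i = c"
    using eigenvector_in_span_eq_0[OF assms(1,3) _ assms(4,5)] \<open>x \<noteq> 0\<close> by blast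
  have "g i \<in> g ` I" using i(1) by blast
  then obtain a where "x - a *s g i \<in> vec.span (g ` I - {g i})"
    using vec.span_breakdown \<open>x \<in> vec.span (g ` I)\<close> by blast
  moreover have "g ` I - {g i} \<subseteq> g ` (I - {i})" by blast
  ultimately have "x - a *s g i \<in> vec.span (g ` (I - {i}))" using vec.span_mono by blast
  moreover have "H *v (x - a *s g i) = c *s (x - a *s g i)"
    using assms(3,5) i by (simp add: vec.diff vec.scale algebra_simps)
  moreover have "ev j \<noteq> c" if "j \<in> I - {i}" for j
    using that i \<open>inj_on ev I\<close> by (auto dest: inj_onD)
  ultimately have "x - a *s g i = 0"
    using assms(1,3) by (intro eigenvector_in_span_eq_0[of "I - {i}" H g ev c]) auto
  then show ?thesis using that i(1) by auto
qed

lemma eigenvalue_chain_terminates: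
  fixes H A :: "'a::field_char_0^'n^'n"
  assumes "\<And>k. H *v ((*v) A ^^ k) w = (c + of_nat k * d) *s ((*v) A ^^ k) w"
    and "d \<noteq> 0" "w \<noteq> 0"
  obtains m where "((*v) A ^^ m) w \<noteq> 0" "((*v) A ^^ Suc m) w = 0"
proof (rule ccontr)
  assume "\<not> thesis"
  with that have "((*v) A ^^ m) w \<noteq> 0 \<Longrightarrow> ((*v) A ^^ Suc m) w \<noteq> 0" for m by blast
  then have nonzero: "((*v) A ^^ k) w \<noteq> 0" for k
    by (induction k) (use \<open>w \<noteq> 0\<close> in auto)
  have "inj_on (\<lambda>k. c + of_nat k * d) {..CARD('n)}"
    using \<open>d \<noteq> 0\<close> by (auto intro: inj_onI)
  from independent_eigenvectors[OF finite_atMost this assms(1) nonzero]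
  have "card ((\<lambda>k. ((*v) A ^^ k) w) ` {..CARD('n)}) = Suc CARD('n)"
    and "vec.independent ((\<lambda>k. ((*v) A ^^ k) w) ` {..CARD('n)})"
    by (simp_all add: card_image)
  then have "Suc CARD('n) \<le> vec.dim (UNIV :: ('a^'n) set)"
    by (metis subset_UNIV vec.independent_card_le_dim)
  then show False by (simp only: vec_dim_card)
qed

lemma csubspace_iff_vec_subspace: "csubspace S \<longleftrightarrow> vec.subspace S"
  by (auto simp: csubspace_def vec.subspace_def)

lemma irreducible_rep_span_eq_UNIV:
  assumes "irreducible_rep E F H"
    and "(*v) E ` B \<subseteq> vec.span B" "(*v) F ` B \<subseteq> vec.span B" "(*v) H ` B \<subseteq> vec.span B"
    and "w \<in> B" "w \<noteq> 0"
  shows "vec.span B = UNIV"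
proof -
  have "csubspace (vec.span B)"
    by (simp add: csubspace_iff_vec_subspace)
  moreover have "vec.span B \<noteq> {0}" using assms(5,6) vec.span_base by blast
  ultimately show ?thesis
    using assms(1-4) matrix_vector_mult_in_span unfolding irreducible_rep_def by blast
qed

lemma tensor_sl2E: "tensor w sl2E = (w, 0, 0)"
  by (simp add: tensor_def sl2E_def)

lemma tensor_sl2H: "tensor w sl2H = (0, 0, w)"
  by (simp add: tensor_def sl2H_def)

lemma tact_sl2E: "tact E F H sl2E (x, y, z) = (E *v x - 2 *s z, E *v y, E *v z + y)"
  by (simp add: tact_def tensor_def rep_def sl2E_def sl2F_def sl2H_def sl2_bracket_def vec_eq_iff)

lemma tact_sl2F: "tact E F H sl2F (x, y, z) = (F *v x, F *v y + 2 *s z, F *v z - x)"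
  by (simp add: tact_def tensor_def rep_def sl2E_def sl2F_def sl2H_def sl2_bracket_def vec_eq_iff)

lemma tact_sl2H: "tact E F H sl2H (x, y, z) = (H *v x + 2 *s x, H *v y - 2 *s y, H *v z)"
  by (simp add: tact_def tensor_def rep_def sl2E_def sl2F_def sl2H_def sl2_bracket_def vec_eq_iff)

lemma E_overshear:
  assumes "E *v (E *v w) = 0"
  shows "(w, 0, 0) \<in> overshears E F H"
proof -
  have "rep E F H sl2E (rep E F H sl2E w) = 0" using assms by (simp add: rep_def sl2E_def)
  then show ?thesis unfolding overshears_def tensor_sl2E[symmetric] by blast
qed

lemma generated_tsubmodule: "tsubmodule E F H (generated E F H X)"
  unfolding tsubmodule_def generated_def by auto

lemma generated_superset: "X \<subseteq> generated E F H X"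
  unfolding generated_def by auto

context
  fixes E F H :: "complex^'n^'n" and S :: "'n tens set"
  assumes S: "tsubmodule E F H S"
begin

lemma tsubmodule_lincomb:
  assumes "(a, b, c) \<in> S" "(a', b', c') \<in> S"
  shows "(k *s a + l *s a', k *s b + l *s b', k *s c + l *s c') \<in> S"
proof -
  have "tscale k (a, b, c) + tscale l (a', b', c') \<in> S"
    using S assms by (simp add: tsubmodule_def)
  then show ?thesis by (simp add: tscale_def)
qed

lemma tsubmodule_unscale:
  assumes "(c *s a, c *s b, c *s d) \<in> S" "c \<noteq> 0"
  shows "(a, b, d) \<in> S"
proof -
  have "tscale (1 / c) (c *s a, c *s b, c *s d) \<in> S"
    using S assms(1) by (simp add: tsubmodule_def)
  then show ?thesis using assms(2) by (simp add: tscale_def)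
qed

lemma tsubmodule_actE: "(a, b, c) \<in> S \<Longrightarrow> (E *v a - 2 *s c, E *v b, E *v c + b) \<in> S"
  using S unfolding tsubmodule_def by (metis tact_sl2E)

lemma tsubmodule_actF: "(a, b, c) \<in> S \<Longrightarrow> (F *v a, F *v b + 2 *s c, F *v c - a) \<in> S"
  using S unfolding tsubmodule_def by (metis tact_sl2F)

lemma tsubmodule_actH: "(a, b, c) \<in> S \<Longrightarrow> (H *v a + 2 *s a, H *v b - 2 *s b, H *v c) \<in> S"
  using S unfolding tsubmodule_def by (metis tact_sl2H)

lemma tsubmodule_eq_UNIV:
  assumes "irreducible_rep E F H" "w \<noteq> 0"
    and "(w, 0, 0) \<in> S" "(0, w, 0) \<in> S" "(0, 0, w) \<in> S"
  shows "S = UNIV"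
proof -
  \<comment> \<open>T is E,F,H-stable: \<xi>(x \<otimes> \<eta>) = \<xi>x \<otimes> \<eta> + x \<otimes> [\<xi>,\<eta>], and x \<otimes> [\<xi>,\<eta>] \<in> S for x \<in> T.\<close>
  define T where "T = {x. (x, 0, 0) \<in> S \<and> (0, x, 0) \<in> S \<and> (0, 0, x) \<in> S}"
  have lincomb: "k *s x + l *s y \<in> T" if "x \<in> T" "y \<in> T" for k l x y
    using that tsubmodule_lincomb[of _ _ _ _ _ _ k l] unfolding T_def by fastforce
  have "w \<in> T" using assms(3-5) unfolding T_def by simp
  then have "csubspace T"
    unfolding csubspace_def using lincomb[of w w 0 0] lincomb[of _ _ 1 1] lincomb[of _ _ _ 0]
    by simp
  moreover have "E *v x \<in> T \<and> F *v x \<in> T \<and> H *v x \<in> T" if "x \<in> T" for x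
  proof -
    have x: "(x, 0, 0) \<in> S" "(0, x, 0) \<in> S" "(0, 0, x) \<in> S" using that unfolding T_def by auto
    have "(E *v x, 0, 0) \<in> S" using tsubmodule_actE[OF x(1)] by simp
    moreover have "(0, E *v x, 0) \<in> S"
      using tsubmodule_lincomb[OF tsubmodule_actE[OF x(2)] x(3), of 1 "-1"] by simp
    moreover have "(0, 0, E *v x) \<in> S"
      using tsubmodule_lincomb[OF tsubmodule_actE[OF x(3)] x(1), of 1 2] by simp
    moreover have "(F *v x, 0, 0) \<in> S"
      using tsubmodule_lincomb[OF tsubmodule_actF[OF x(1)] x(3), of 1 1] by simp
    moreover have "(0, F *v x, 0) \<in> S" using tsubmodule_actF[OF x(2)] by simp
    moreover have "(0, 0, F *v x) \<in> S"
      using tsubmodule_lincomb[OF tsubmodule_actF[OF x(3)] x(2), of 1 "-2"] by simp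
    moreover have "(H *v x, 0, 0) \<in> S"
      using tsubmodule_lincomb[OF tsubmodule_actH[OF x(1)] x(1), of 1 "-2"] by simp
    moreover have "(0, H *v x, 0) \<in> S"
      using tsubmodule_lincomb[OF tsubmodule_actH[OF x(2)] x(2), of 1 2] by simp
    moreover have "(0, 0, H *v x) \<in> S" using tsubmodule_actH[OF x(3)] by simp
    ultimately show ?thesis unfolding T_def by simp
  qed
  moreover have "T \<noteq> {0}" using \<open>w \<in> T\<close> \<open>w \<noteq> 0\<close> by auto
  ultimately have "T = UNIV" using assms(1) unfolding irreducible_rep_def by blast
  show ?thesis
  proof safe
    fix x y z :: "complex^'n"
    have xyz: "(x, 0, 0) \<in> S" "(0, y, 0) \<in> S" "(0, 0, z) \<in> S"
      using \<open>T = UNIV\<close> unfolding T_def by auto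
    have "(x, y, 0) \<in> S" using tsubmodule_lincomb[OF xyz(1,2), of 1 1] by simp
    from tsubmodule_lincomb[OF this xyz(3), of 1 1] show "(x, y, z) \<in> S" by simp
  qed simp
qed

end

locale sl2_rep =
  fixes E F H :: "complex^'n^'n"
  assumes is_sl2_rep: "is_sl2_rep E F H"
begin

abbreviation Fpow :: "nat \<Rightarrow> complex^'n \<Rightarrow> complex^'n" where
  "Fpow k \<equiv> (*v) F ^^ k"

lemma HE_commute: "H *v (E *v w) = E *v (H *v w) + 2 *s (E *v w)"
proof -
  have "H ** E = E ** H + mat 2 ** E"
    using is_sl2_rep by (simp add: is_sl2_rep_def algebra_simps)
  then have "(H ** E) *v w = (E ** H + mat 2 ** E) *v w" by simp
  then show ?thesis
    by (simp add: matrix_vector_mult_add_rdistrib matrix_vector_mul_assoc[symmetric]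
        matrix_vector_mul_mat)
qed

lemma HF_commute: "H *v (F *v w) = F *v (H *v w) - 2 *s (F *v w)"
proof -
  have "H ** F = F ** H - mat 2 ** F"
    using is_sl2_rep by (simp add: is_sl2_rep_def algebra_simps)
  then have "(H ** F) *v w = (F ** H - mat 2 ** F) *v w" by simp
  then show ?thesis
    by (simp add: matrix_vector_mult_diff_rdistrib matrix_vector_mul_assoc[symmetric]
        matrix_vector_mul_mat)
qed

lemma EF_commute: "E *v (F *v w) = F *v (E *v w) + H *v w"
proof -
  have "E ** F = F ** E + H"
    using is_sl2_rep by (simp add: is_sl2_rep_def algebra_simps)
  then have "(E ** F) *v w = (F ** E + H) *v w" by simp
  then show ?thesis by (simp add: matrix_vector_mult_add_rdistrib matrix_vector_mul_assoc[symmetric])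
qed

lemma E_eigenvector: "H *v w = c *s w \<Longrightarrow> H *v (E *v w) = (c + 2) *s (E *v w)"
  by (simp add: HE_commute vec.scale algebra_simps)

lemma F_eigenvector: "H *v w = c *s w \<Longrightarrow> H *v (F *v w) = (c + - 2) *s (F *v w)"
  by (simp add: HF_commute vec.scale algebra_simps)

lemma Fpow_eigenvector:
  "H *v u = \<mu> *s u \<Longrightarrow> H *v Fpow k u = (\<mu> + of_nat k * - 2) *s Fpow k u"
  by (rule funpow_eigenvector[OF F_eigenvector])

lemma E_Fpow_highest_weight:
  assumes "E *v u = 0" "H *v u = \<mu> *s u"
  shows "E *v Fpow (Suc k) u = (of_nat (Suc k) * (\<mu> - of_nat k)) *s Fpow k u"
proof (induction k)
  case 0
  then show ?case using assms by (simp add: EF_commute)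
next
  case (Suc k)
  have "E *v Fpow (Suc (Suc k)) u = F *v (E *v Fpow (Suc k) u) + H *v Fpow (Suc k) u"
    by (simp add: EF_commute)
  also have "\<dots> = (of_nat (Suc k) * (\<mu> - of_nat k) + (\<mu> + of_nat (Suc k) * - 2)) *s Fpow (Suc k) u"
    using Suc Fpow_eigenvector[OF assms(2), of "Suc k"] by (simp add: vec.scale)
  also have "\<dots> = (of_nat (Suc (Suc k)) * (\<mu> - of_nat (Suc k))) *s Fpow (Suc k) u"
    by (simp add: algebra_simps)
  finally show ?case .
qed

lemma highest_weight_eq_length:
  assumes "E *v u = 0" "H *v u = \<mu> *s u" "Fpow K u \<noteq> 0" "Fpow (Suc K) u = 0"
  shows "\<mu> = of_nat K"
proof -
  have "(of_nat (Suc K) * (\<mu> - of_nat K)) *s Fpow K u = 0"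
    using E_Fpow_highest_weight[OF assms(1,2), of K] assms(4) by simp
  then show ?thesis using assms(3) by (simp del: of_nat_Suc)
qed

lemma eigenvector_multiple_Fpow:
  assumes "H *v u = \<mu> *s u" "vec.span ((\<lambda>k. Fpow k u) ` {..K}) = UNIV"
    and "H *v v = lam *s v" "v \<noteq> 0"
  obtains m a where "m \<le> K" "v = a *s Fpow m u"
proof -
  have "inj_on (\<lambda>k. \<mu> + of_nat k * - 2) {..K}" by (auto intro: inj_onI)
  from eigenvector_in_span_eq_multiple[OF finite_atMost this Fpow_eigenvector[OF assms(1)]]
  show ?thesis using assms(2-4) that by auto
qed

lemma tsubmodule_Fpow_orbits:
  assumes S: "tsubmodule E F H S" "overshears E F H \<subseteq> S"
    and u: "E *v u = 0" "H *v u = \<mu> *s u"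
  shows "(0, (2 * of_nat (Suc k)) *s Fpow k u, Fpow (Suc k) u) \<in> S"
    and "(Fpow (Suc (Suc k)) u, (- (of_nat (Suc (Suc k)) * of_nat (Suc k))) *s Fpow k u,
          (- of_nat (Suc (Suc k))) *s Fpow (Suc k) u) \<in> S"
proof -
  have u_in: "(u, 0, 0) \<in> S"
    using S(2) E_overshear[of E u F H] u(1) by auto
  have "E *v (E *v (F *v u)) = 0"
    using E_Fpow_highest_weight[OF u, of 0] u(1) by (simp add: vec.scale)
  then have Fu_in: "(F *v u, 0, 0) \<in> S"
    using S(2) E_overshear by blast
  have "(0, 0, u) \<in> S"
    using tsubmodule_lincomb[OF S(1) tsubmodule_actF[OF S(1) u_in] Fu_in, of "-1" 1] by simp
  then show "(0, (2 * of_nat (Suc k)) *s Fpow k u, Fpow (Suc k) u) \<in> S"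
  proof (induction k)
    case 0
    then show ?case using tsubmodule_actF[OF S(1) \<open>(0, 0, u) \<in> S\<close>] by simp
  next
    case (Suc k)
    show ?case
      by (rule back_subst[where P = "\<lambda>x. x \<in> S",
            OF tsubmodule_actF[OF S(1) Suc.IH[OF Suc.prems]]])
        (simp add: vec.scale vec.neg vec_eq_iff algebra_simps)
  qed
  show "(Fpow (Suc (Suc k)) u, (- (of_nat (Suc (Suc k)) * of_nat (Suc k))) *s Fpow k u,
          (- of_nat (Suc (Suc k))) *s Fpow (Suc k) u) \<in> S"
  proof (induction k)
    case 0
    show ?case
      by (rule back_subst[where P = "\<lambda>x. x \<in> S",
            OF tsubmodule_actF[OF S(1) tsubmodule_actF[OF S(1) u_in]]])
        (simp add: vec.neg vec_eq_iff)
  next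
    case (Suc k)
    show ?case
      by (rule back_subst[where P = "\<lambda>x. x \<in> S", OF tsubmodule_actF[OF S(1) Suc]])
        (simp add: vec.scale vec.neg vec_eq_iff algebra_simps)
  qed
qed

end

locale sl2_irrep = sl2_rep +
  assumes irreducible: "irreducible_rep E F H"
begin

lemma span_Fpow_eq_UNIV:
  assumes "E *v u = 0" "H *v u = \<mu> *s u" "u \<noteq> 0" "Fpow (Suc K) u = 0"
  shows "vec.span ((\<lambda>k. Fpow k u) ` {..K}) = UNIV"
proof -
  let ?B = "(\<lambda>k. Fpow k u) ` {..K}"
  have in_span: "c *s Fpow k u \<in> vec.span ?B" if "k \<le> K" for c k
    using that by (intro vec.span_scale vec.span_base) auto
  have "E *v Fpow k u \<in> vec.span ?B" if "k \<le> K" for k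
  proof (cases k)
    case 0
    then show ?thesis using assms(1) by (simp add: vec.span_zero)
  next
    case (Suc i)
    then show ?thesis using that in_span E_Fpow_highest_weight[OF assms(1,2)] by simp
  qed
  moreover have "F *v Fpow k u \<in> vec.span ?B" if "k \<le> K" for k
  proof (cases "Suc k \<le> K")
    case True
    then show ?thesis using in_span[of "Suc k" 1] by simp
  next
    case False
    with that have "k = K" by simp
    then show ?thesis using assms(4) by (simp add: vec.span_zero)
  qed
  moreover have "H *v Fpow k u \<in> vec.span ?B" if "k \<le> K" for k
    using in_span[OF that] Fpow_eigenvector[OF assms(2)] by metis
  ultimately show ?thesis
    using assms(3) by (intro irreducible_rep_span_eq_UNIV[OF irreducible, of _ u]) force+
qed

lemma highest_weight_string:
  assumes "H *v v = lam *s v" "v \<noteq> 0"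
  obtains u and K :: nat where "E *v u = 0" "H *v u = of_nat K *s u"
    and "\<And>k. k \<le> K \<Longrightarrow> Fpow k u \<noteq> 0" "Fpow (Suc K) u = 0"
    and "vec.span ((\<lambda>k. Fpow k u) ` {..K}) = UNIV"
proof -
  obtain j where "((*v) E ^^ j) v \<noteq> 0" "((*v) E ^^ Suc j) v = 0"
    using eigenvalue_chain_terminates[OF funpow_eigenvector[OF E_eigenvector assms(1)] _ assms(2)]
    by auto
  define u where "u = ((*v) E ^^ j) v"
  have u: "u \<noteq> 0" "E *v u = 0" "H *v u = (lam + of_nat j * 2) *s u"
    using \<open>((*v) E ^^ j) v \<noteq> 0\<close> \<open>((*v) E ^^ Suc j) v = 0\<close>
      funpow_eigenvector[OF E_eigenvector assms(1)]
    by (simp_all add: u_def)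
  obtain K where K: "Fpow K u \<noteq> 0" "Fpow (Suc K) u = 0"
    using eigenvalue_chain_terminates[OF Fpow_eigenvector[OF u(3)] _ u(1)] by auto
  have "lam + of_nat j * 2 = of_nat K"
    by (rule highest_weight_eq_length[OF u(2,3) K])
  with u K show ?thesis
    using that span_Fpow_eq_UNIV[OF u(2,3,1) K(2)] funpow_matrix_vector_mult_eq_0_mono[where A = F]
    by metis
qed

lemma weight_vector_inside_string:
  assumes "H *v v = lam *s v" "E *v v \<noteq> 0" "F *v v \<noteq> 0"
  obtains u K m a where "E *v u = 0" "H *v u = of_nat K *s u"
    and "\<And>k. k \<le> K \<Longrightarrow> Fpow k u \<noteq> 0" "0 < m" "m < K" "a \<noteq> 0" "v = a *s Fpow m u"
proof -
  have "v \<noteq> 0" using assms(2) by auto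
  obtain u K where u: "E *v u = 0" "H *v u = of_nat K *s u"
    and nonzero: "\<And>k. k \<le> K \<Longrightarrow> Fpow k u \<noteq> 0" and last: "Fpow (Suc K) u = 0"
    and span: "vec.span ((\<lambda>k. Fpow k u) ` {..K}) = UNIV"
    using highest_weight_string[OF assms(1) \<open>v \<noteq> 0\<close>] by blast
  obtain m a where "m \<le> K" and v: "v = a *s Fpow m u"
    using eigenvector_multiple_Fpow[OF u(2) span assms(1) \<open>v \<noteq> 0\<close>] by blast
  have "m \<noteq> 0" using v u(1) assms(2) by (cases m) (auto simp: vec.scale)
  moreover have "m \<noteq> K" using v last assms(3) by (auto simp: vec.scale)
  moreover have "a \<noteq> 0" using v \<open>v \<noteq> 0\<close> by auto
  ultimately show ?thesis using that[OF u nonzero _ _ _ v] \<open>m \<le> K\<close> by simp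
qed

lemma tsubmodule_eq_UNIV_if_middle_weight:
  assumes S: "tsubmodule E F H S" "overshears E F H \<subseteq> S"
    and u: "E *v u = 0" "H *v u = of_nat K *s u"
    and nonzero: "\<And>k. k \<le> K \<Longrightarrow> Fpow k u \<noteq> 0"
    and m: "0 < m" "m < K" and weight_in: "(0, 0, Fpow m u) \<in> S"
  shows "S = UNIV"
proof -
  obtain i where i: "m = Suc i" using m(1) gr0_conv_Suc by blast
  note orbit = tsubmodule_Fpow_orbits[OF S u, of i]
  note E_Fpow = E_Fpow_highest_weight[OF u]
  have nz_F_prev: "(2 * of_nat m :: complex) \<noteq> 0"
    and nz_E_mid: "(of_nat (Suc m) * (of_nat K - of_nat m) :: complex) \<noteq> 0"
    and nz_prev: "(of_nat m * (of_nat K - of_nat i) :: complex) \<noteq> 0"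
    using m i by (auto simp del: of_nat_Suc)
  have "(0, (2 * of_nat m) *s Fpow i u, 0) \<in> S"
    using tsubmodule_lincomb[OF S(1) orbit(1) weight_in, of 1 "-1"] i by simp
  then have F_prev: "(0, Fpow i u, 0) \<in> S"
    using tsubmodule_unscale[OF S(1) _ nz_F_prev, of 0 "Fpow i u" 0] by simp
  have "(0, (of_nat (Suc m) * of_nat m) *s Fpow i u, of_nat (Suc m) *s Fpow m u) \<in> S"
    using tsubmodule_lincomb[OF S(1) F_prev weight_in, of "of_nat (Suc m) * of_nat m" "of_nat (Suc m)"]
    by simp
  with i have "(0, (of_nat (Suc (Suc i)) * of_nat (Suc i)) *s Fpow i u,
      of_nat (Suc (Suc i)) *s Fpow (Suc i) u) \<in> S" by simp
  from tsubmodule_lincomb[OF S(1) orbit(2) this, of 1 1] i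
  have "(Fpow (Suc m) u, 0, 0) \<in> S" by simp
  from tsubmodule_actE[OF S(1) this]
  have "((of_nat (Suc m) * (of_nat K - of_nat m)) *s Fpow m u, 0, 0) \<in> S"
    using E_Fpow[of m] by simp
  then have E_mid: "(Fpow m u, 0, 0) \<in> S"
    using tsubmodule_unscale[OF S(1) _ nz_E_mid, of _ 0 0] by simp
  have "((of_nat m * (of_nat K - of_nat i)) *s Fpow i u, 0, 0) \<in> S"
    using tsubmodule_actE[OF S(1) E_mid] E_Fpow[of i] i by simp
  then have E_prev: "(Fpow i u, 0, 0) \<in> S"
    using tsubmodule_unscale[OF S(1) _ nz_prev, of _ 0 0] by simp
  have "(0, 0, (of_nat m * (of_nat K - of_nat i)) *s Fpow i u) \<in> S"
    using tsubmodule_lincomb[OF S(1) tsubmodule_actE[OF S(1) weight_in] E_mid, of 1 2] E_Fpow[of i] i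
    by simp
  then have H_prev: "(0, 0, Fpow i u) \<in> S"
    using tsubmodule_unscale[OF S(1) _ nz_prev, of 0 0] by simp
  show ?thesis
    using tsubmodule_eq_UNIV[OF S(1) irreducible nonzero E_prev F_prev H_prev] m i by simp
qed

end

theorem proposition5p4:
  fixes E F H :: "complex^'n^'n" and v :: "complex^'n" and lam :: complex
  assumes "is_sl2_rep E F H"
    and "irreducible_rep E F H"
    and "H *v v = lam *s v"
    and "lam \<noteq> 0"
    and "E *v v \<noteq> 0"
    and "F *v v \<noteq> 0"
  shows "generated E F H (insert (tensor v sl2H) (overshears E F H)) = UNIV"
proof -
  interpret sl2_irrep E F H
    using assms(1,2) by (intro sl2_irrep.intro sl2_rep.intro sl2_irrep_axioms.intro)
  obtain u K m a where u: "E *v u = 0" "H *v u = of_nat K *s u"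
    and nonzero: "\<And>k. k \<le> K \<Longrightarrow> Fpow k u \<noteq> 0" and m: "0 < m" "m < K"
    and "a \<noteq> 0" and v: "v = a *s Fpow m u"
    using weight_vector_inside_string[OF assms(3,5,6)] by blast
  define M where "M = generated E F H (insert (tensor v sl2H) (overshears E F H))"
  have M: "tsubmodule E F H M" "overshears E F H \<subseteq> M"
    using generated_tsubmodule generated_superset unfolding M_def by blast+
  have "(0, 0, a *s Fpow m u) \<in> M"
    using generated_superset unfolding M_def tensor_sl2H v by blast
  then have "(0, 0, Fpow m u) \<in> M"
    using tsubmodule_unscale[OF M(1) _ \<open>a \<noteq> 0\<close>, of 0 0] by simp
  with M u nonzero m show ?thesis
    unfolding M_def by (rule tsubmodule_eq_UNIV_if_middle_weight)
qed

end
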